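(* Let $A$ be a totally ordered alphabet and let $w=\ell_1\ell_2\cdots\ell_n$ where $\ell_1,\dots,\ell_n$ are Lyndon words with $\ell_1^\omega\ge\ell_2^\omega\ge\cdots\ge\ell_n^\omega$. Then $\ell_n$ is the shortest among all nonempty suffixes $s$ of $w$ for which $s^\omega$ is minimum (i.e. $s^\omega\le s'^\omega$ for every nonempty suffix $s'$ of $w$).
   Context: The order $<$ on finite and infinite words is the lexicographical order induced by the order of $A$. For a nonempty finite word $x$, $x^\omega=xxx\cdots$. A nonempty word $w$ is a Lyndon word if for every factorization $w=uv$ with $u,v$ nonempty one has $w<v$. *)

theory Defs
  imports
    "HOL-Library.List_Lexorder"
    "HOL-Library.Sublist"
    "HOL-Library.Stream"
    "HOL-Library.Fun_Lexorder"
begin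

text \<open>
  Finite words over the alphabet are lists, compared by the instance of the class
  \<^class>\<open>linorder\<close> in \<^theory>\<open>HOL-Library.List_Lexorder\<close> (a proper prefix is smaller).
  Infinite words are streams. The infinite power of a nonempty word \<open>x\<close> is \<open>cycle x\<close>;
  \<open>cycle []\<close> is an unspecified stream, so nonemptiness is always required explicitly.
\<close>

definition stream_le :: "'a::linorder stream \<Rightarrow> 'a stream \<Rightarrow> bool"  (infix "\<le>\<^sub>s" 50)
  where "s \<le>\<^sub>s t \<longleftrightarrow> less_fun (snth s) (snth t) \<or> s = t"

definition Lyndon :: "'a::linorder list \<Rightarrow> bool"
  where "Lyndon w \<longleftrightarrow> w \<noteq> [] \<and> (\<forall>u v. w = u @ v \<longrightarrow> u \<noteq> [] \<longrightarrow> v \<noteq> [] \<longrightarrow> w < v)"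

definition omega_min_suffix :: "'a::linorder list \<Rightarrow> 'a list \<Rightarrow> bool"
  where "omega_min_suffix w s \<longleftrightarrow>
    suffix s w \<and> s \<noteq> [] \<and> (\<forall>s'. suffix s' w \<longrightarrow> s' \<noteq> [] \<longrightarrow> cycle s \<le>\<^sub>s cycle s')"

end

theory Submission
  imports Defs
begin

text \<open>
  For an infinite word \<open>z\<close> and a nonempty word \<open>u\<close>, the comparisons of \<open>z\<close> with \<open>u\<^sup>\<omega>\<close> and with
  \<open>u z\<close> have the same outcome. Since left multiplication by a word is monotone, the words \<open>u\<close>
  with \<open>z \<le> u z\<close> are closed under concatenation. For \<open>z = \<ell>\<^sub>n\<^sup>\<omega>\<close> they contain every \<open>\<ell>\<^sub>i\<close>, and every
  nonempty suffix of \<open>\<ell>\<^sub>i\<close>: if \<open>t\<close> is a proper such suffix, then \<open>\<ell>\<^sub>i < t\<close> and \<open>t\<close> is shorter than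
  \<open>\<ell>\<^sub>i\<close>, so the first mismatch lies inside \<open>t\<close> and \<open>\<ell>\<^sub>i\<^sup>\<omega> < t \<ell>\<^sub>i\<^sup>\<omega>\<close>. Strictness of this last
  inequality for \<open>i = n\<close> rules out shorter minimizers.
\<close>

lemma snth_cycle_add_length:
  assumes "u \<noteq> []"
  shows "cycle u !! (length u + i) = cycle u !! i"
  using arg_cong[OF cycle_decomp[OF assms], of "\<lambda>s. s !! (length u + i)"] by simp

text \<open>Prepending \<open>u\<close> moves the agreement of \<open>z\<close> with the periodic
  word \<open>cycle u\<close> right by \<open>length u\<close>. This length is at least 1, so the
  agreement gains a position: the bound is \<open>j \<le> k\<close>, not
  \<open>j < k\<close>.\<close>

lemma snth_shift_eq_cycle:
  assumes "u \<noteq> []" and "\<forall>i<k. z !! i = cycle u !! i" and "j \<le> k"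
  shows "(u @- z) !! j = cycle u !! j"
proof (cases "j < length u")
  case True
  then show ?thesis
    using arg_cong[OF cycle_decomp[OF assms(1)], of "\<lambda>s. s !! j"] by simp
next
  case False
  then have "j - length u < k"
    using assms(1,3) by (cases u) auto
  then show ?thesis
    using False assms snth_cycle_add_length[of u "j - length u"]
    by (simp add: shift_snth_ge)
qed

text \<open>Under agreement below \<open>k\<close>, \<open>u @- z\<close> and \<open>cycle u\<close>
  carry the same letter at \<open>k\<close> as well, so both conditions pass to \<open>Suc k\<close>
  together.\<close>

lemma agree_shift_iff_agree_cycle:
  assumes "u \<noteq> []"
  shows "(\<forall>i<k. z !! i = (u @- z) !! i) \<longleftrightarrow> (\<forall>i<k. z !! i = cycle u !! i)"
  by (induction k) (use snth_shift_eq_cycle[OF assms] in \<open>auto simp: less_Suc_eq\<close>)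

text \<open>If \<open>z\<close> first differs at \<open>k\<close> from one of the two words on the
  right, these words share their first \<open>k + 1\<close> letters, so the mismatch is the same for
  both.\<close>

lemma less_fun_cycle_iff:
  assumes "u \<noteq> []"
  shows "less_fun (snth z) (snth (cycle u)) \<longleftrightarrow> less_fun (snth z) (snth (u @- z))"
proof -
  have "z !! k < cycle u !! k \<and> (\<forall>i<k. z !! i = cycle u !! i) \<longleftrightarrow>
      z !! k < (u @- z) !! k \<and> (\<forall>i<k. z !! i = (u @- z) !! i)" for k
    using agree_shift_iff_agree_cycle[OF assms, of k z] snth_shift_eq_cycle[OF assms, of k z k]
    by auto
  then show ?thesis
    unfolding less_fun_def by simp
qed

lemma eq_cycle_iff:
  assumes "u \<noteq> []"
  shows "z = cycle u \<longleftrightarrow> z = u @- z"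
proof
  assume "z = u @- z"
  then have "z !! i = cycle u !! i" for i
    using agree_shift_iff_agree_cycle[OF assms, of "Suc i" z] by (metis lessI)
  then show "z = cycle u"
    \<comment> \<open>With \<open>id\<close> as the map, \<open>smap_alt\<close> is extensionality
      for streams.\<close>
    using smap_alt[of id z "cycle u"] by (simp add: stream.map_id)
qed (use cycle_decomp[OF assms] in blast)

lemma stream_le_cycle_iff:
  assumes "u \<noteq> []"
  shows "z \<le>\<^sub>s cycle u \<longleftrightarrow> z \<le>\<^sub>s u @- z"
  using less_fun_cycle_iff[OF assms] eq_cycle_iff[OF assms] by (simp add: stream_le_def)

lemma stream_le_refl: "s \<le>\<^sub>s s"
  by (simp add: stream_le_def)

lemma stream_le_trans: "s \<le>\<^sub>s t \<Longrightarrow> t \<le>\<^sub>s r \<Longrightarrow> s \<le>\<^sub>s r"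
  unfolding stream_le_def by (metis less_fun_trans)

lemma stream_le_shift:
  assumes "s \<le>\<^sub>s t"
  shows "u @- s \<le>\<^sub>s u @- t"
proof (cases "s = t")
  case False
  then obtain k where k: "s !! k < t !! k" "\<forall>i<k. s !! i = t !! i"
    using assms by (auto simp: stream_le_def less_fun_def)
  have "(u @- s) !! (length u + k) < (u @- t) !! (length u + k)"
    using k(1) by simp
  moreover have "(u @- s) !! i = (u @- t) !! i" if "i < length u + k" for i
    using that k(2) by (cases "i < length u") auto
  ultimately show ?thesis
    unfolding stream_le_def less_fun_def by blast
qed (simp add: stream_le_refl)

lemma stream_le_shift_append:
  assumes "z \<le>\<^sub>s u @- z" and "z \<le>\<^sub>s v @- z"
  shows "z \<le>\<^sub>s (u @ v) @- z"
  using stream_le_trans[OF assms(1) stream_le_shift[OF assms(2)]] by simp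

lemma stream_le_shift_concat:
  assumes "\<And>u. u \<in> set us \<Longrightarrow> z \<le>\<^sub>s u @- z"
  shows "z \<le>\<^sub>s concat us @- z"
  using assms by (induction us) (simp_all add: stream_le_refl stream_le_shift_append del: shift_append)

text \<open>The length bound keeps \<open>xs\<close> from being a proper prefix of
  \<open>ys\<close>, which leaves a mismatch as the only cause of \<open>xs < ys\<close>.\<close>

lemma less_list_mismatch:
  fixes xs ys :: "'a::linorder list"
  assumes "xs < ys" and "length ys \<le> length xs"
  obtains k where "k < length ys" "xs ! k < ys ! k" "\<forall>i<k. xs ! i = ys ! i"
proof -
  have "(xs, ys) \<in> lexord {(a, b). a < b}"
    using assms(1) by (simp add: list_less_def)
  then show thesis
    using assms(2) that
    by (auto simp: lexord_take_index_conv list_eq_iff_nth_eq)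
qed

lemma Lyndon_not_Nil: "Lyndon w \<Longrightarrow> w \<noteq> []"
  by (simp add: Lyndon_def)

lemma Lyndon_less_shift_suffix:
  assumes "Lyndon l" and "strict_suffix t l" and "t \<noteq> []"
  shows "less_fun (snth (cycle l)) (snth (t @- cycle l))"
proof -
  obtain p where p: "l = p @ t" "p \<noteq> []"
    using assms(2) by (auto simp: strict_suffix_def suffix_def)
  then have "l < t"
    using assms(1,3) by (auto simp: Lyndon_def)
  then obtain k where k: "k < length t" "l ! k < t ! k" "\<forall>i<k. l ! i = t ! i"
    using p(1) less_list_mismatch[of l t] by auto
  \<comment> \<open>The mismatch lies inside \<open>t\<close>, hence inside the first copy of
    \<open>l\<close> in \<open>cycle l\<close>.\<close>
  have "cycle l !! i = l ! i" if "i \<le> k" for i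
  proof -
    have "i < length l" "l \<noteq> []"
      using that k(1) p by auto
    then show ?thesis
      using arg_cong[OF cycle_decomp[of l], of "\<lambda>s. s !! i"] by simp
  qed
  then show ?thesis
    using k unfolding less_fun_def by (intro exI[of _ k]) simp
qed

lemma Lyndon_cycle_less_cycle_suffix:
  assumes "Lyndon l" and "strict_suffix t l" and "t \<noteq> []"
  shows "less_fun (snth (cycle l)) (snth (cycle t))"
  using Lyndon_less_shift_suffix[OF assms] less_fun_cycle_iff[OF assms(3)] by blast

lemma Lyndon_cycle_le_cycle_suffix:
  assumes "Lyndon l" and "suffix t l" and "t \<noteq> []"
  shows "cycle l \<le>\<^sub>s cycle t"
  using Lyndon_cycle_less_cycle_suffix[OF assms(1) _ assms(3)] assms(2)
  by (cases "t = l") (auto simp: stream_le_def strict_suffix_def)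

text \<open>Here \<open>u\<close> is the factor in which \<open>s\<close> begins. Membership in
  \<open>set us\<close> is recorded for the later factors because it is the input of
  \<open>stream_le_shift_concat\<close>.\<close>

lemma suffix_concatE:
  assumes "suffix s (concat us)" and "s \<noteq> []"
  obtains u us' t where "u \<in> set us" "set us' \<subseteq> set us" "suffix t u" "t \<noteq> []" "s = t @ concat us'"
  using assms
proof (induction us arbitrary: thesis)
  case (Cons u us)
  show ?case
  proof (cases "suffix s (concat us)")
    case True
    then show ?thesis
      using Cons.IH[OF _ _ Cons.prems(3)] Cons.prems(1)
      by (metis list.set_intros(2) set_subset_Cons subset_trans)
  next
    case False
    then obtain t where "s = t @ concat us" "suffix t u"
      using Cons.prems(2) by (auto simp: suffix_append)
    \<comment> \<open>An empty \<open>t\<close> would make \<open>s\<close> equal to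
      \<open>concat us\<close>, contrary to this case.\<close>
    then show ?thesis
      using False Cons.prems(1)[of u us t] by (auto simp: suffix_def)
  qed
qed simp

lemma last_stream_le:
  assumes "successively (\<lambda>l l'. cycle l' \<le>\<^sub>s cycle l) ls" and "l \<in> set ls"
  shows "cycle (last ls) \<le>\<^sub>s cycle l"
  using assms
proof (induction ls arbitrary: l)
  case (Cons a ls)
  show ?case
  proof (cases "ls = []")
    case True
    then show ?thesis
      using Cons.prems(2) by (simp add: stream_le_refl)
  next
    case False
    then have "cycle (hd ls) \<le>\<^sub>s cycle a" and IH: "\<And>x. x \<in> set ls \<Longrightarrow> cycle (last ls) \<le>\<^sub>s cycle x"
      using Cons by (simp_all add: successively_Cons)
    then have "cycle (last ls) \<le>\<^sub>s cycle a"
      using False hd_in_set stream_le_trans by blast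
    then show ?thesis
      using False IH Cons.prems(2) by auto
  qed
qed simp

theorem theorem5:
  fixes ls :: "'a::linorder list list" and w :: "'a list"
  assumes "ls \<noteq> []"
    and "\<forall>l \<in> set ls. Lyndon l"
    and "successively (\<lambda>l l'. cycle l' \<le>\<^sub>s cycle l) ls"
    and "w = concat ls"
  shows "is_arg_min length (omega_min_suffix w) (last ls)"
proof -
  define l where "l = last ls"
  have l: "l \<in> set ls" "Lyndon l" "l \<noteq> []"
    using assms(1,2) by (simp_all add: l_def Lyndon_not_Nil)
  have w: "suffix l w"
    using assms(1,4) by (cases ls rule: rev_cases) (auto simp: l_def suffix_def)
  have suffix_le: "cycle l \<le>\<^sub>s cycle t" if "x \<in> set ls" "suffix t x" "t \<noteq> []" for t x
  proof (rule stream_le_trans)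
    show "cycle l \<le>\<^sub>s cycle x"
      unfolding l_def using last_stream_le[OF assms(3) that(1)] .
    show "cycle x \<le>\<^sub>s cycle t"
      using Lyndon_cycle_le_cycle_suffix that assms(2) by blast
  qed
  have min: "cycle l \<le>\<^sub>s cycle s" if s_w: "suffix s w" "s \<noteq> []" for s
  proof -
    obtain x us t where s: "x \<in> set ls" "set us \<subseteq> set ls" "suffix t x" "t \<noteq> []" "s = t @ concat us"
      using s_w unfolding assms(4) by (rule suffix_concatE)
    \<comment> \<open>A whole factor is a suffix of itself, so \<open>suffix_le\<close> covers it
      too.\<close>
    have "cycle l \<le>\<^sub>s u @- cycle l" if "u \<in> set us" for u
    proof -
      have "u \<in> set ls" "u \<noteq> []"
        using that s(2) assms(2) Lyndon_not_Nil by blast+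
      then show ?thesis
        using suffix_le[of u u] by (simp add: stream_le_cycle_iff)
    qed
    then have "cycle l \<le>\<^sub>s concat us @- cycle l"
      by (rule stream_le_shift_concat)
    moreover have "cycle l \<le>\<^sub>s t @- cycle l"
      using suffix_le s by (simp flip: stream_le_cycle_iff)
    ultimately show ?thesis
      using stream_le_shift_append stream_le_cycle_iff[OF s_w(2)] s(5) by blast
  qed
  have "\<not> length s < length l" if s: "omega_min_suffix w s" for s
  proof
    assume "length s < length l"
    \<comment> \<open>Of two suffixes of \<open>w\<close>, the shorter is a suffix of the
      longer.\<close>
    then have "strict_suffix s l"
      using s w by (auto simp: omega_min_suffix_def strict_suffix_def intro: suffix_length_suffix)
    then have "less_fun (snth (cycle l)) (snth (cycle s))"
      using s l(2) by (simp add: omega_min_suffix_def Lyndon_cycle_less_cycle_suffix)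
    moreover have "cycle s \<le>\<^sub>s cycle l"
      using s w l(3) by (simp add: omega_min_suffix_def)
    ultimately show False
      unfolding stream_le_def by (metis less_fun_asym)
  qed
  moreover have "omega_min_suffix w l"
    using min w l(3) by (simp add: omega_min_suffix_def)
  ultimately show ?thesis
    unfolding is_arg_min_def l_def by blast
qed

end
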